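(* Let $R$ be a commutative ring with unity, $Y\subseteq\mathrm{Spec}(R)$ and $I=k(Y)$. If $Y\subseteq\mathrm{Min}(I)$, then the following statements are equivalent. (a) $R$ has the $h_Y$-property. (b) For every finite set $F\subseteq R$ there is some $c\in R$ such that $(I:F)=(I:c)$. (c) For every $a,b\in R$ there is some $c\in R$ such that $(I:a)\cap(I:b)=(I:c)$. (d) $R/I$ is an a.c. ring.
   Context: $h_Y(S)=\{P\in Y: S\subseteq P\}$ for $S\subseteq R$, $h_Y(a)=h_Y(\{a\})$, and $k(Y)=\bigcap_{P\in Y}P$ (with $k(\emptyset)=R$). $\mathrm{Min}(I)$ is the set of prime ideals minimal over $I$. $(I:S)=\{x\in R: xS\subseteq I\}$ and $(I:a)=(I:\{a\})$. $R$ has the $h_Y$-property if for all $a,b\in R$ there is $c\in R$ with $h_Y(a)\cap h_Y(b)=h_Y(c)$. A ring $T$ is an a.c. ring (satisfies the annihilator condition) if for each finite set $F\subseteq T$ there is $c\in T$ with $\mathrm{Ann}(F)=\mathrm{Ann}(c)$. *)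

theory Defs
  imports "HOL-Algebra.QuotRing"
begin

definition Spec :: "('a, 'm) ring_scheme \<Rightarrow> 'a set set" where
  "Spec R = {P. primeideal P R}"

definition hull :: "'a set set \<Rightarrow> 'a set \<Rightarrow> 'a set set" where
  "hull Y S = {P \<in> Y. S \<subseteq> P}"

text \<open>The intersection with the carrier makes the kernel of the empty family the whole ring.\<close>

definition kernel_of :: "('a, 'm) ring_scheme \<Rightarrow> 'a set set \<Rightarrow> 'a set" where
  "kernel_of R Y = carrier R \<inter> \<Inter>Y"

definition Min_primes :: "('a, 'm) ring_scheme \<Rightarrow> 'a set \<Rightarrow> 'a set set" where
  "Min_primes R I =
     {P \<in> Spec R. I \<subseteq> P \<and> (\<forall>Q \<in> Spec R. I \<subseteq> Q \<and> Q \<subseteq> P \<longrightarrow> Q = P)}"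

definition ideal_colon :: "('a, 'm) ring_scheme \<Rightarrow> 'a set \<Rightarrow> 'a set \<Rightarrow> 'a set" where
  "ideal_colon R I S = {x \<in> carrier R. \<forall>s \<in> S. x \<otimes>\<^bsub>R\<^esub> s \<in> I}"

definition Ann :: "('a, 'm) ring_scheme \<Rightarrow> 'a set \<Rightarrow> 'a set" where
  "Ann R S = {x \<in> carrier R. \<forall>s \<in> S. x \<otimes>\<^bsub>R\<^esub> s = \<zero>\<^bsub>R\<^esub>}"

definition h_property :: "('a, 'm) ring_scheme \<Rightarrow> 'a set set \<Rightarrow> bool" where
  "h_property R Y \<longleftrightarrow>
     (\<forall>a \<in> carrier R. \<forall>b \<in> carrier R. \<exists>c \<in> carrier R. hull Y {a} \<inter> hull Y {b} = hull Y {c})"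

definition ac_ring :: "('a, 'm) ring_scheme \<Rightarrow> bool" where
  "ac_ring T \<longleftrightarrow>
     cring T \<and> (\<forall>F. finite F \<and> F \<subseteq> carrier T \<longrightarrow> (\<exists>c \<in> carrier T. Ann T F = Ann T {c}))"

end

theory Submission
  imports Defs
begin

text \<open>A prime \<open>P\<close> that is minimal over the radical ideal \<open>I\<close> contains \<open>a\<close> exactly when \<open>(I : a)\<close>
  is not contained in \<open>P\<close>. If \<open>I = k(Y)\<close> with \<open>Y \<subseteq> Min(I)\<close>, then for finite sets \<open>F\<close> the hull
  \<open>h_Y(F)\<close> and the ideal \<open>(I : F)\<close> thus determine each other: \<open>(I : F)\<close> is the intersection of
  the members of \<open>Y\<close> outside \<open>h_Y(F)\<close>, and \<open>h_Y(F)\<close> consists of the \<open>P \<in> Y\<close> with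
  \<open>(I : F)\<close> not contained in \<open>P\<close>. Annihilators in \<open>R/I\<close> are the images of the ideals \<open>(I : F)\<close>.\<close>

section \<open>Existence of primes that avoid a multiplicative set\<close>

lemma (in ring) ideal_chain_Union:
  assumes ne: "\<C> \<noteq> {}"
    and ideals: "\<And>J. J \<in> \<C> \<Longrightarrow> ideal J R"
    and chain: "\<And>J K. J \<in> \<C> \<Longrightarrow> K \<in> \<C> \<Longrightarrow> J \<subseteq> K \<or> K \<subseteq> J"
  shows "ideal (\<Union>\<C>) R"
proof (rule idealI[OF ring_axioms])
  have sub: "additive_subgroup J R" if "J \<in> \<C>" for J
    using ideals[OF that] by (rule ideal.axioms(1))
  show "subgroup (\<Union>\<C>) (add_monoid R)"
  proof (rule add.subgroupI)
    show "\<Union>\<C> \<subseteq> carrier R"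
      using additive_subgroup.a_subset[OF sub] by blast
    show "\<Union>\<C> \<noteq> {}"
      using ne additive_subgroup.zero_closed[OF sub] by blast
    show "\<ominus> x \<in> \<Union>\<C>" if "x \<in> \<Union>\<C>" for x
      using that additive_subgroup.a_inv_closed[OF sub] by blast
    show "x \<oplus> y \<in> \<Union>\<C>" if x: "x \<in> \<Union>\<C>" and y: "y \<in> \<Union>\<C>" for x y
    proof -
      obtain J where "J \<in> \<C>" "x \<in> J" "y \<in> J"
        using x y chain by blast
      then show ?thesis
        using additive_subgroup.a_closed[OF sub] by blast
    qed
  qed
  show "x \<otimes> a \<in> \<Union>\<C>" "a \<otimes> x \<in> \<Union>\<C>" if "a \<in> \<Union>\<C>" "x \<in> carrier R" for a x
    using that ideal.I_l_closed[OF ideals] ideal.I_r_closed[OF ideals] by blast+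
qed

text \<open>Krull's argument: Zorn's lemma gives an ideal \<open>M\<close> maximal among those that
  contain \<open>I\<close> and miss \<open>S\<close>. If \<open>a\<close> and \<open>b\<close> lay
  outside \<open>M\<close> with \<open>a \<otimes> b\<close> inside, then \<open>PIdl a + M\<close>
  and \<open>PIdl b + M\<close> would both meet \<open>S\<close>, and the product of the two meeting
  elements would lie in both \<open>M\<close> and \<open>S\<close>.\<close>

lemma (in cring) primeideal_avoiding_multiplicative_set:
  assumes I: "ideal I R"
    and S: "\<one> \<in> S" "\<And>s t. s \<in> S \<Longrightarrow> t \<in> S \<Longrightarrow> s \<otimes> t \<in> S"
    and disj: "I \<inter> S = {}"
  obtains Q where "primeideal Q R" "I \<subseteq> Q" "Q \<inter> S = {}"
proof -
  define \<A> where "\<A> = {J. ideal J R \<and> I \<subseteq> J \<and> J \<inter> S = {}}"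
  have "\<exists>M\<in>\<A>. \<forall>X\<in>\<A>. M \<subseteq> X \<longrightarrow> X = M"
  proof (rule subset_Zorn_nonempty)
    show "\<A> \<noteq> {}"
      using I disj by (auto simp: \<A>_def)
    fix \<C> assume ne: "\<C> \<noteq> {}" and "subset.chain \<A> \<C>"
    then have sub: "\<C> \<subseteq> \<A>" and chain: "\<And>J K. J \<in> \<C> \<Longrightarrow> K \<in> \<C> \<Longrightarrow> J \<subseteq> K \<or> K \<subseteq> J"
      by (auto simp: subset_chain_def)
    have "ideal (\<Union>\<C>) R"
      using sub by (intro ideal_chain_Union ne chain) (auto simp: \<A>_def)
    moreover have "I \<subseteq> \<Union>\<C>" "\<Union>\<C> \<inter> S = {}"
      using sub ne by (auto simp: \<A>_def)
    ultimately show "\<Union>\<C> \<in> \<A>"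
      by (simp add: \<A>_def)
  qed
  then obtain M where M: "ideal M R" "I \<subseteq> M" "M \<inter> S = {}"
    and max: "\<And>X. X \<in> \<A> \<Longrightarrow> M \<subseteq> X \<Longrightarrow> X = M"
    by (auto simp: \<A>_def)
  interpret M: ideal M R by (rule M(1))
  have meets: "\<exists>r\<in>carrier R. \<exists>m\<in>M. r \<otimes> a \<oplus> m \<in> S" if a: "a \<in> carrier R" "a \<notin> M" for a
  proof -
    let ?K = "set_add R (PIdl a) M"
    have K: "ideal ?K R"
      by (intro add_ideals cgenideal_ideal a M)
    have "Idl (PIdl a \<union> M) = ?K"
      by (intro union_genideal cgenideal_ideal a M)
    moreover have "PIdl a \<union> M \<subseteq> carrier R"
      using a by (auto simp: cgenideal_def)
    ultimately have "PIdl a \<union> M \<subseteq> ?K"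
      using genideal_self by metis
    moreover have "a \<in> PIdl a"
      by (rule cgenideal_self[OF a(1)])
    ultimately have "M \<subseteq> ?K" "?K \<noteq> M"
      using a by auto
    with max have "?K \<notin> \<A>"
      by blast
    with K M(2) \<open>M \<subseteq> ?K\<close> have "?K \<inter> S \<noteq> {}"
      by (auto simp: \<A>_def)
    then show ?thesis
      by (auto simp: set_add_defs cgenideal_def)
  qed
  have "primeideal M R"
  proof (rule primeidealI[OF M(1) cring_axioms])
    show "carrier R \<noteq> M"
      using S(1) M(3) one_closed by blast
    fix a b assume ab: "a \<in> carrier R" "b \<in> carrier R" "a \<otimes> b \<in> M"
    show "a \<in> M \<or> b \<in> M"
    proof (rule ccontr)
      assume "\<not> ?thesis"
      then obtain r m s n where r: "r \<in> carrier R" "m \<in> M" "r \<otimes> a \<oplus> m \<in> S"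
        and s: "s \<in> carrier R" "n \<in> M" "s \<otimes> b \<oplus> n \<in> S"
        using meets ab by meson
      have carr: "m \<in> carrier R" "n \<in> carrier R"
        using r s M.Icarr by auto
      \<comment> \<open>Expanded so that every summand has a factor in \<open>M\<close>:
        \<open>a \<otimes> b\<close>, \<open>n\<close> or \<open>m\<close>.\<close>
      have "(r \<otimes> a \<oplus> m) \<otimes> (s \<otimes> b \<oplus> n)
          = (r \<otimes> s) \<otimes> (a \<otimes> b) \<oplus> ((r \<otimes> a) \<otimes> n \<oplus> m \<otimes> (s \<otimes> b \<oplus> n))"
        using ab r(1) s(1) carr by algebra
      also have "\<dots> \<in> M"
        by (rule M.a_closed[OF M.I_l_closed M.a_closed[OF M.I_l_closed M.I_r_closed]])
          (use ab r(1,2) s(1,2) carr in auto)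
      finally show False
        using S(2)[OF r(3) s(3)] M(3) by blast
    qed
  qed
  with M that show thesis
    by blast
qed

section \<open>Kernels, colon ideals and minimal primes\<close>

context cring
begin

lemma ideal_kernel_of:
  assumes "Y \<subseteq> Spec R"
  shows "ideal (kernel_of R Y) R"
proof -
  \<comment> \<open>Inserting \<open>carrier R\<close> makes the family nonempty, so that the case
    \<open>Y = {}\<close> is covered.\<close>
  have "ideal (\<Inter>(insert (carrier R) Y)) R"
    using assms oneideal by (intro i_Intersect) (auto simp: Spec_def primeideal_def)
  then show ?thesis
    by (simp add: kernel_of_def)
qed

lemma Spec_mult_iff:
  assumes "P \<in> Spec R" "x \<in> carrier R" "y \<in> carrier R"
  shows "x \<otimes> y \<in> P \<longleftrightarrow> x \<in> P \<or> y \<in> P"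
proof -
  interpret primeideal P R
    using assms(1) by (simp add: Spec_def)
  show ?thesis
    using I_prime[OF assms(2,3)] I_l_closed[OF _ assms(2)] I_r_closed[OF _ assms(3)] by blast
qed

lemma Spec_pow_iff:
  assumes "P \<in> Spec R" "a \<in> carrier R"
  shows "a [^] (n::nat) \<in> P \<longleftrightarrow> n \<noteq> 0 \<and> a \<in> P"
proof (induction n)
  case 0
  interpret primeideal P R
    using assms(1) by (simp add: Spec_def)
  show ?case
    using I_notcarr one_imp_carrier by auto
next
  case (Suc n)
  then show ?case
    using assms by (auto simp: Spec_mult_iff)
qed

lemma kernel_mult_iff:
  assumes "Y \<subseteq> Spec R" "x \<in> carrier R" "y \<in> carrier R"
  shows "x \<otimes> y \<in> kernel_of R Y \<longleftrightarrow> (\<forall>P\<in>Y. x \<in> P \<or> y \<in> P)"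
proof -
  have "x \<otimes> y \<in> kernel_of R Y \<longleftrightarrow> (\<forall>P\<in>Y. x \<otimes> y \<in> P)"
    using assms(2,3) by (simp add: kernel_of_def)
  also have "\<dots> \<longleftrightarrow> (\<forall>P\<in>Y. x \<in> P \<or> y \<in> P)"
    using Spec_mult_iff[OF subsetD[OF assms(1)] assms(2,3)] by blast
  finally show ?thesis .
qed

text \<open>If \<open>(I : a)\<close> were inside \<open>P\<close>, the multiplicative set of all
  \<open>x \<otimes> a [^] n\<close> with \<open>x\<close> outside \<open>P\<close> would miss
  \<open>I\<close>. A prime \<open>Q\<close> over \<open>I\<close> that misses this set lies inside
  \<open>P\<close> and omits \<open>a\<close>, against the minimality of \<open>P\<close>.\<close>

lemma Min_primes_avoid_colon:
  assumes Y: "Y \<subseteq> Spec R" and P: "P \<in> Min_primes R (kernel_of R Y)" and a: "a \<in> P"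
  shows "\<exists>x\<in>ideal_colon R (kernel_of R Y) {a}. x \<notin> P"
proof (rule ccontr)
  let ?I = "kernel_of R Y"
  assume neg: "\<not> ?thesis"
  have PS: "P \<in> Spec R"
    and min: "\<And>Q. Q \<in> Spec R \<Longrightarrow> ?I \<subseteq> Q \<Longrightarrow> Q \<subseteq> P \<Longrightarrow> Q = P"
    using P unfolding Min_primes_def by blast+
  interpret P: primeideal P R
    using PS by (simp add: Spec_def)
  have aR: "a \<in> carrier R"
    using a by (rule P.Icarr)
  \<comment> \<open>The exponent 0 puts all of \<open>carrier R - P\<close> into \<open>S\<close>,
    which forces \<open>Q\<close> into \<open>P\<close>; the choice \<open>x = \<one>\<close>,
    \<open>n = 1\<close> puts \<open>a\<close> into \<open>S\<close>.\<close>
  define S where "S = {x \<otimes> a [^] n |x (n::nat). x \<in> carrier R - P}"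
  have one: "\<one> \<in> carrier R - P"
    using P.I_notcarr P.one_imp_carrier by auto
  have "\<one> \<otimes> a [^] (0::nat) \<in> S"
    unfolding S_def using one by blast
  then have S1: "\<one> \<in> S"
    by simp
  have "\<one> \<otimes> a [^] (1::nat) \<in> S"
    unfolding S_def using one by blast
  then have aS: "a \<in> S"
    using aR by simp
  have S2: "s \<otimes> t \<in> S" if st: "s \<in> S" "t \<in> S" for s t
  proof -
    obtain x y and n m :: nat where xy: "x \<in> carrier R - P" "y \<in> carrier R - P"
      and s: "s = x \<otimes> a [^] n" and t: "t = y \<otimes> a [^] m"
      using st by (auto simp: S_def)
    have "s \<otimes> t = (x \<otimes> y) \<otimes> (a [^] n \<otimes> a [^] m)"
      using xy aR by (simp add: s t m_ac)
    also have "\<dots> = (x \<otimes> y) \<otimes> a [^] (n + m)"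
      using aR by (simp add: nat_pow_mult)
    finally have "s \<otimes> t = (x \<otimes> y) \<otimes> a [^] (n + m)" .
    moreover have "x \<otimes> y \<in> carrier R - P"
      using xy by (simp add: Spec_mult_iff[OF PS])
    ultimately show ?thesis
      unfolding S_def by blast
  qed
  have "?I \<inter> S = {}"
  proof (rule ccontr)
    assume "?I \<inter> S \<noteq> {}"
    then obtain x and n :: nat where x: "x \<in> carrier R" "x \<notin> P" "x \<otimes> a [^] n \<in> ?I"
      by (auto simp: S_def)
    \<comment> \<open>The kernel is an intersection of primes, so the exponent of \<open>a\<close>
      can be reduced to 1.\<close>
    then have "x \<otimes> a \<in> ?I"
      using aR Y by (auto simp: kernel_mult_iff Spec_pow_iff subset_iff)
    with x neg show False
      by (auto simp: ideal_colon_def)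
  qed
  then obtain Q where Q: "primeideal Q R" "?I \<subseteq> Q" "Q \<inter> S = {}"
    using primeideal_avoiding_multiplicative_set[OF ideal_kernel_of[OF Y] S1 S2] by blast
  have "x \<in> S" if "x \<in> carrier R - P" for x
  proof -
    have "x \<otimes> a [^] (0::nat) \<in> S"
      unfolding S_def using that by blast
    then show ?thesis
      using that by simp
  qed
  moreover have "Q \<subseteq> carrier R"
    using Q(1) ideal.Icarr by (auto simp: primeideal_def)
  ultimately have "Q \<subseteq> P"
    using Q(3) by blast
  with min Q have "Q = P"
    by (simp add: Spec_def)
  with a aS Q(3) show False
    by blast
qed

text \<open>A prime that contains \<open>F\<close> imposes no condition on \<open>x\<close>, while
  any other prime of \<open>Y\<close> forces \<open>x\<close> into itself. Hence the hull of
  \<open>F\<close> determines the colon ideal.\<close>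

lemma ideal_colon_kernel:
  assumes "Y \<subseteq> Spec R" "F \<subseteq> carrier R"
  shows "ideal_colon R (kernel_of R Y) F = {x \<in> carrier R. \<forall>P\<in>Y - hull Y F. x \<in> P}"
proof -
  have "(\<forall>s\<in>F. x \<otimes> s \<in> kernel_of R Y) \<longleftrightarrow> (\<forall>P\<in>Y - hull Y F. x \<in> P)"
    if "x \<in> carrier R" for x
  proof -
    have "(\<forall>s\<in>F. x \<otimes> s \<in> kernel_of R Y) \<longleftrightarrow> (\<forall>s\<in>F. \<forall>P\<in>Y. x \<in> P \<or> s \<in> P)"
      using kernel_mult_iff[OF assms(1) that] assms(2) by blast
    also have "\<dots> \<longleftrightarrow> (\<forall>P\<in>Y - hull Y F. x \<in> P)"
      unfolding hull_def by blast
    finally show ?thesis .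
  qed
  then show ?thesis
    by (auto simp: ideal_colon_def)
qed

text \<open>If some \<open>x\<close> outside \<open>P\<close> multiplies \<open>F\<close> into
  \<open>I\<close>, then primeness of \<open>P\<close> puts \<open>F\<close> into \<open>P\<close>.
  Conversely, minimality gives a multiplier outside \<open>P\<close> for each element of
  \<open>F\<close>, and the product of these finitely many multipliers stays outside
  \<open>P\<close>.\<close>

lemma Min_primes_contains_finite_iff:
  assumes Y: "Y \<subseteq> Spec R" and P: "P \<in> Min_primes R (kernel_of R Y)"
    and F: "finite F" "F \<subseteq> carrier R"
  shows "F \<subseteq> P \<longleftrightarrow> \<not> ideal_colon R (kernel_of R Y) F \<subseteq> P"
proof
  let ?I = "kernel_of R Y"
  have PS: "P \<in> Spec R" and IP: "?I \<subseteq> P"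
    using P by (auto simp: Min_primes_def)
  show "F \<subseteq> P" if "\<not> ideal_colon R ?I F \<subseteq> P"
  proof
    fix s assume "s \<in> F"
    then show "s \<in> P"
      using that IP PS F(2) Spec_mult_iff by (fastforce simp: ideal_colon_def)
  qed
  show "\<not> ideal_colon R ?I F \<subseteq> P" if "F \<subseteq> P"
    using F that
  proof (induction F rule: finite_induct)
    case empty
    \<comment> \<open>The colon by the empty set is the whole ring, so \<one> serves as the
      multiplier; it arises here as a zeroth power.\<close>
    have "\<one> \<notin> P"
      using Spec_pow_iff[OF PS zero_closed, of 0] by simp
    then show ?case
      by (auto simp: ideal_colon_def)
  next
    case (insert a F)
    then obtain x where x: "x \<in> carrier R" "\<And>s. s \<in> F \<Longrightarrow> x \<otimes> s \<in> ?I" "x \<notin> P"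
      by (auto simp: ideal_colon_def)
    obtain y where y: "y \<in> carrier R" "y \<otimes> a \<in> ?I" "y \<notin> P"
      using Min_primes_avoid_colon[OF Y P, of a] insert.prems by (auto simp: ideal_colon_def)
    \<comment> \<open>The factor \<open>x\<close> takes care of \<open>F\<close> and the factor
      \<open>y\<close> of \<open>a\<close>.\<close>
    have "x \<otimes> y \<in> ideal_colon R ?I (insert a F)"
      using x y insert.prems Y
      by (auto simp: ideal_colon_def kernel_mult_iff Spec_mult_iff subset_iff)
    moreover have "x \<otimes> y \<notin> P"
      using x y by (simp add: Spec_mult_iff[OF PS])
    ultimately show ?case
      by blast
  qed
qed

text \<open>From hulls to colons only primeness is used; the way back recovers the hull from the
  colon through minimality.\<close>

lemma hull_eq_iff_ideal_colon_eq:
  assumes Y: "Y \<subseteq> Spec R" "Y \<subseteq> Min_primes R (kernel_of R Y)"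
    and F: "finite F" "F \<subseteq> carrier R" and G: "finite G" "G \<subseteq> carrier R"
  shows "hull Y F = hull Y G
    \<longleftrightarrow> ideal_colon R (kernel_of R Y) F = ideal_colon R (kernel_of R Y) G"
proof
  assume "hull Y F = hull Y G"
  then show "ideal_colon R (kernel_of R Y) F = ideal_colon R (kernel_of R Y) G"
    using Y F G by (simp add: ideal_colon_kernel)
next
  have "hull Y H = {P \<in> Y. \<not> ideal_colon R (kernel_of R Y) H \<subseteq> P}"
    if "finite H" "H \<subseteq> carrier R" for H
    using that Y(2) Min_primes_contains_finite_iff[OF Y(1)] by (simp add: hull_def subset_iff) blast
  then show "hull Y F = hull Y G"
    if "ideal_colon R (kernel_of R Y) F = ideal_colon R (kernel_of R Y) G"
    using that F G by simp
qed

end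

section \<open>Colon ideals by finite sets and annihilators in the quotient\<close>

lemma ideal_colon_insert:
  "ideal_colon R I (insert a F) = ideal_colon R I {a} \<inter> ideal_colon R I F"
  by (auto simp: ideal_colon_def)

text \<open>Induction on \<open>F\<close>: the pair condition merges each new element with the
  single element that already represents the rest.\<close>

lemma (in ideal) ideal_colon_finite_iff_pairs:
  "(\<forall>F. finite F \<and> F \<subseteq> carrier R \<longrightarrow>
      (\<exists>c\<in>carrier R. ideal_colon R I F = ideal_colon R I {c}))
    \<longleftrightarrow> (\<forall>a\<in>carrier R. \<forall>b\<in>carrier R. \<exists>c\<in>carrier R.
      ideal_colon R I {a} \<inter> ideal_colon R I {b} = ideal_colon R I {c})"
  (is "?B \<longleftrightarrow> ?C")
proof
  assume B: ?B
  show ?C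
  proof (intro ballI)
    fix a b assume "a \<in> carrier R" "b \<in> carrier R"
    then show "\<exists>c\<in>carrier R. ideal_colon R I {a} \<inter> ideal_colon R I {b} = ideal_colon R I {c}"
      using B[rule_format, of "{a, b}"] by (simp add: ideal_colon_insert[of R I a "{b}"])
  qed
next
  assume C: ?C
  show ?B
  proof (intro allI impI, elim conjE)
    fix F :: "'a set" assume "finite F" "F \<subseteq> carrier R"
    then show "\<exists>c\<in>carrier R. ideal_colon R I F = ideal_colon R I {c}"
    proof (induction F rule: finite_induct)
      case empty
      show ?case
        \<comment> \<open>Both the colon by the empty set and the colon by \<zero> are the whole
          ring.\<close>
        by (intro bexI[of _ \<zero>]) (auto simp: ideal_colon_def)
    next
      case (insert a F)
      then show ?case
        using C by (metis ideal_colon_insert insert_subset)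
    qed
  qed
qed

lemma (in ideal) Ann_quotient:
  assumes F: "F \<subseteq> carrier R"
  shows "Ann (R Quot I) ((+>) I ` F) = (+>) I ` ideal_colon R I F"
proof -
  have mult: "(I +> x) \<otimes>\<^bsub>R Quot I\<^esub> (I +> s) = I \<longleftrightarrow> x \<otimes> s \<in> I"
    if "x \<in> carrier R" "s \<in> carrier R" for x s
  proof -
    have "(I +> x) \<otimes>\<^bsub>R Quot I\<^esub> (I +> s) = I +> x \<otimes> s"
      using that by (simp add: FactRing_def rcoset_mult_add)
    moreover have "I +> x \<otimes> s = I \<longleftrightarrow> x \<otimes> s \<in> I"
      using that rcos_const_imp_mem[of "x \<otimes> s"] a_rcos_const[of "x \<otimes> s"] by auto
    ultimately show ?thesis
      by simp
  qed
  have "carrier (R Quot I) = (+>) I ` carrier R" "\<zero>\<^bsub>R Quot I\<^esub> = I"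
    by (auto simp: FactRing_simps)
  then have "Ann (R Quot I) ((+>) I ` F)
      = (+>) I ` {x \<in> carrier R. \<forall>s\<in>F. (I +> x) \<otimes>\<^bsub>R Quot I\<^esub> (I +> s) = I}"
    unfolding Ann_def by auto
  also have "{x \<in> carrier R. \<forall>s\<in>F. (I +> x) \<otimes>\<^bsub>R Quot I\<^esub> (I +> s) = I} = ideal_colon R I F"
    unfolding ideal_colon_def using mult F by blast
  finally show ?thesis .
qed

text \<open>The colon ideal is a union of cosets of \<open>I\<close>, since \<open>I\<close> absorbs
  products with \<open>F\<close>. It can therefore be recovered from its image in the
  quotient.\<close>

lemma (in ideal) mem_ideal_colon_iff_coset:
  assumes F: "F \<subseteq> carrier R" and x: "x \<in> carrier R"
  shows "x \<in> ideal_colon R I F \<longleftrightarrow> I +> x \<in> (+>) I ` ideal_colon R I F"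
proof
  assume "I +> x \<in> (+>) I ` ideal_colon R I F"
  then obtain y where y: "y \<in> carrier R" "\<And>s. s \<in> F \<Longrightarrow> y \<otimes> s \<in> I" and eq: "I +> x = I +> y"
    by (auto simp: ideal_colon_def)
  have "x \<in> I +> y"
    using a_rcos_self[OF x] eq by simp
  then obtain i where i: "i \<in> I" "x = i \<oplus> y"
    by (auto simp: a_r_coset_def r_coset_def)
  have "x \<otimes> s \<in> I" if "s \<in> F" for s
    using that F y i by (simp add: subset_iff l_distr I_r_closed Icarr)
  with x show "x \<in> ideal_colon R I F"
    by (simp add: ideal_colon_def)
qed auto

lemma (in ideal) Ann_quotient_eq_iff:
  assumes "F \<subseteq> carrier R" "G \<subseteq> carrier R"
  shows "Ann (R Quot I) ((+>) I ` F) = Ann (R Quot I) ((+>) I ` G)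
    \<longleftrightarrow> ideal_colon R I F = ideal_colon R I G"
proof -
  have "ideal_colon R I H = {x \<in> carrier R. I +> x \<in> (+>) I ` ideal_colon R I H}"
    if "H \<subseteq> carrier R" for H
    using mem_ideal_colon_iff_coset[OF that] by (auto simp: ideal_colon_def)
  then show ?thesis
    using assms by (metis Ann_quotient)
qed

lemma (in ideal) ac_ring_quotient_iff:
  assumes "cring R"
  shows "ac_ring (R Quot I) \<longleftrightarrow> (\<forall>F. finite F \<and> F \<subseteq> carrier R \<longrightarrow>
    (\<exists>c\<in>carrier R. ideal_colon R I F = ideal_colon R I {c}))"
proof -
  have carr: "carrier (R Quot I) = (+>) I ` carrier R"
    by (auto simp: FactRing_simps)
  have eq: "Ann (R Quot I) ((+>) I ` F) = Ann (R Quot I) {I +> c}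
      \<longleftrightarrow> ideal_colon R I F = ideal_colon R I {c}" if "F \<subseteq> carrier R" "c \<in> carrier R" for F c
    using Ann_quotient_eq_iff[of F "{c}"] that by simp
  \<comment> \<open>Choosing representatives lifts a finite set of cosets to a finite subset of
    \<open>carrier R\<close>.\<close>
  have "(\<forall>F. finite F \<and> F \<subseteq> (+>) I ` carrier R \<longrightarrow> Q F)
      \<longleftrightarrow> (\<forall>F. finite F \<and> F \<subseteq> carrier R \<longrightarrow> Q ((+>) I ` F))" for Q
    by (metis finite_imageI finite_subset_image image_mono)
  then show ?thesis
    using quotient_is_cring[OF assms] eq by (simp add: ac_ring_def carr)
qed

text \<open>Intersecting over \<open>a\<close> and \<open>b\<close> gives the hull or colon of
  \<open>{a, b}\<close> on either side, so the correspondence for finite sets applies to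
  \<open>{a, b}\<close> and \<open>{c}\<close>.\<close>

lemma (in cring) h_property_iff:
  assumes "Y \<subseteq> Spec R" "Y \<subseteq> Min_primes R (kernel_of R Y)"
  shows "h_property R Y \<longleftrightarrow> (\<forall>a\<in>carrier R. \<forall>b\<in>carrier R. \<exists>c\<in>carrier R.
    ideal_colon R (kernel_of R Y) {a} \<inter> ideal_colon R (kernel_of R Y) {b}
      = ideal_colon R (kernel_of R Y) {c})"
proof -
  have "hull Y {a} \<inter> hull Y {b} = hull Y {a, b}" for a b
    by (auto simp: hull_def)
  moreover have "ideal_colon R I {a} \<inter> ideal_colon R I {b} = ideal_colon R I {a, b}" for I a b
    by (simp add: ideal_colon_insert[of R I a "{b}"])
  ultimately show ?thesis
    using assms by (simp add: h_property_def hull_eq_iff_ideal_colon_eq)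
qed

theorem proposition3p15:
  fixes R :: "('a, 'm) ring_scheme" and Y :: "'a set set" and I :: "'a set"
  assumes "cring R"
    and "Y \<subseteq> Spec R"
    and "I = kernel_of R Y"
    and "Y \<subseteq> Min_primes R I"
  defines "stmt_a \<equiv> h_property R Y"
    and "stmt_b \<equiv> \<forall>F. finite F \<and> F \<subseteq> carrier R \<longrightarrow>
                    (\<exists>c \<in> carrier R. ideal_colon R I F = ideal_colon R I {c})"
    and "stmt_c \<equiv> \<forall>a \<in> carrier R. \<forall>b \<in> carrier R. \<exists>c \<in> carrier R.
                    ideal_colon R I {a} \<inter> ideal_colon R I {b} = ideal_colon R I {c}"
    and "stmt_d \<equiv> ac_ring (R Quot I)"
  shows "(stmt_a \<longleftrightarrow> stmt_b) \<and> (stmt_b \<longleftrightarrow> stmt_c) \<and> (stmt_c \<longleftrightarrow> stmt_d)"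
proof -
  interpret cring R by fact
  interpret ideal I R
    using ideal_kernel_of[OF assms(2)] assms(3) by simp
  have "stmt_a \<longleftrightarrow> stmt_c"
    using h_property_iff assms(2,3,4) by (simp add: stmt_a_def stmt_c_def)
  moreover have "stmt_b \<longleftrightarrow> stmt_c"
    unfolding stmt_b_def stmt_c_def by (rule ideal_colon_finite_iff_pairs)
  moreover have "stmt_d \<longleftrightarrow> stmt_b"
    unfolding stmt_d_def stmt_b_def by (rule ac_ring_quotient_iff) fact
  ultimately show ?thesis
    by blast
qed

end
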